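(* Let $r$ be a complex number and $n\ge1$ an integer. Then, as polynomials in $x$, $$(n+1)d_{n+1}^{(r)}(x)=(1+2x)d_n^{(r)}(x)+(n+2r)d_{n-1}^{(r)}(x).$$
   Context: For a complex number $a$ and integer $k\ge0$, $\binom{a}{k}=a(a-1)\cdots(a-k+1)/k!$. For a parameter $r$ and an integer $n\ge 0$, $d_n^{(r)}(x)=\sum_{k=0}^n\binom{x+r+k}{k}\binom{x-r}{n-k}$. *)

theory Defs
  imports Complex_Main "HOL-Computational_Algebra.Polynomial"
begin

text \<open>
  The library's \<open>gchoose\<close> is restricted to fields, so the binomial coefficient with a
  polynomial as upper argument is spelled out here.  The lemma \<open>poly_binom_poly\<close> relates it
  to \<open>gchoose\<close> on the complex numbers.
\<close>

definition binom_poly :: "complex poly \<Rightarrow> nat \<Rightarrow> complex poly" where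
  "binom_poly p k = smult (1 / fact k) (\<Prod>i<k. p - of_nat i)"

text \<open>\<open>[:r + of_nat k, 1:]\<close> is $x + r + k$ and \<open>[:- r, 1:]\<close> is $x - r$.\<close>

definition d_poly :: "complex \<Rightarrow> nat \<Rightarrow> complex poly" where
  "d_poly r n =
    (\<Sum>k\<le>n. binom_poly [:r + of_nat k, 1:] k * binom_poly [:- r, 1:] (n - k))"

lemma poly_binom_poly: "poly (binom_poly p k) x = poly p x gchoose k"
  by (simp add: binom_poly_def gbinomial_prod_rev poly_prod lessThan_atLeast0)

lemma poly_d_poly:
  "poly (d_poly r n) x = (\<Sum>k\<le>n. (x + r + of_nat k gchoose k) * (x - r gchoose (n - k)))"
  by (simp add: d_poly_def poly_sum poly_binom_poly algebra_simps)

end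

theory Submission
  imports Defs "HOL-Computational_Algebra.Formal_Power_Series"
begin

text \<open>
  For fixed \<open>x\<close> the numbers $d_n^{(r)}(x)$ have the generating function
  $D(t) = (1-t)^{-(x+r+1)}(1+t)^{x-r}$. Its logarithmic derivative gives the differential equation
  $(1-t^2)D' = ((2x+1)+(2r+1)t)D$, and the recurrence compares coefficients of $t^n$.
\<close>

unbundle fps_syntax

text \<open>\<open>A\<close> is the expansion of (1-t)^(-(a+1)). Absorption turns the coefficient
  n+1 of \<open>A\<close> into a + n + 1 times the coefficient n, which is the equation read off at
  t^n.\<close>

lemma fps_shifted_binomial_deriv:
  fixes a :: "'a::field_char_0"
  defines "A \<equiv> Abs_fps (\<lambda>k. (a + of_nat k) gchoose k)"
  shows "(1 - fps_X) * fps_deriv A = fps_const (a + 1) * A"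
proof (rule fps_ext)
  fix n
  have "of_nat (Suc n) * (a + of_nat (Suc n) gchoose Suc n)
      = (a + of_nat (Suc n)) * (a + of_nat n gchoose n)"
    using gbinomial_absorption[of n "a + of_nat (Suc n)"] by simp
  then show "((1 - fps_X) * fps_deriv A) $ n = (fps_const (a + 1) * A) $ n"
    by (cases n) (simp_all add: A_def algebra_simps)
qed

lemma fps_binomial_ODE:
  "(1 + fps_X) * fps_deriv (fps_binomial b) = fps_const b * fps_binomial (b::'a::field_char_0)"
proof (rule fps_ext)
  fix n
  show "((1 + fps_X) * fps_deriv (fps_binomial b)) $ n = (fps_const b * fps_binomial b) $ n"
    using gbinomial_mult_1[of b n] by (cases n) (simp_all add: algebra_simps)
qed

text \<open>Freeing the upper arguments from x and r makes \<open>d\<close> a plain Cauchy product,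
  so the equations of both factors combine by the product rule.\<close>

lemma gbinomial_convolution_recurrence:
  fixes a b :: "'a::field_char_0"
  defines "d \<equiv> (\<lambda>n. \<Sum>k\<le>n. (a + of_nat k gchoose k) * (b gchoose (n - k)))"
  assumes "n \<ge> 1"
  shows "of_nat (n + 1) * d (n + 1) =
    (a + b + 1) * d n + (of_nat n + a - b) * d (n - 1)"
proof -
  obtain m where n: "n = Suc m"
    using assms(2) by (cases n) auto
  define A where "A = Abs_fps (\<lambda>k. a + of_nat k gchoose k)"
  define B where "B = fps_binomial b"
  define D where "D = A * B"
  have D_nth: "D $ n = d n" for n
    by (simp add: D_def A_def B_def d_def fps_mult_nth atLeast0AtMost)
  have A': "(1 - fps_X) * fps_deriv A = fps_const (a + 1) * A"
    unfolding A_def by (rule fps_shifted_binomial_deriv)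
  have B': "(1 + fps_X) * fps_deriv B = fps_const b * B"
    unfolding B_def by (rule fps_binomial_ODE)
  \<comment> \<open>Since 1 - t^2 = (1-t)(1+t), each summand of the product rule receives the factor
    that its own differential equation needs.\<close>
  have "(1 - fps_X ^ 2) * fps_deriv D
      = (1 + fps_X) * B * ((1 - fps_X) * fps_deriv A)
      + (1 - fps_X) * A * ((1 + fps_X) * fps_deriv B)"
    by (simp add: D_def algebra_simps power2_eq_square)
  also have "\<dots> = (fps_const (a + 1) * (1 + fps_X) + fps_const b * (1 - fps_X)) * D"
    unfolding A' B' by (simp add: D_def algebra_simps)
  also have "\<dots> = fps_const (a + b + 1) * D + fps_const (a + 1 - b) * (fps_X * D)"
    by (simp add: algebra_simps flip: fps_const_add fps_const_sub)
  finally have "((1 - fps_X ^ 2) * fps_deriv D) $ n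
      = (fps_const (a + b + 1) * D + fps_const (a + 1 - b) * (fps_X * D)) $ n"
    by simp
  then have "of_nat (n + 1) * d (n + 1) - of_nat m * d m = (a + b + 1) * d n + (a + 1 - b) * d m"
    \<comment> \<open>For m = 0 the t^2 shift contributes nothing at t^n, in agreement with
      \<open>of_nat m * d m = 0\<close>.\<close>
    by (cases m)
      (simp_all add: n left_diff_distrib fps_X_power_mult_nth mult.assoc D_nth
        del: fps_const_add fps_const_sub)
  then show ?thesis
    by (simp add: n algebra_simps)
qed

theorem theorem2p2:
  fixes r :: complex and n :: nat
  assumes "n \<ge> 1"
  shows "of_nat (n + 1) * d_poly r (n + 1) =
    [:1, 2:] * d_poly r n + [:of_nat n + 2 * r:] * d_poly r (n - 1)"
proof -
  \<comment> \<open>Complex polynomials with equal values everywhere coincide. For a = x + r and b =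
    x - r, the factors a + b + 1 and n + a - b become 1 + 2x and n + 2r.\<close>
  have "poly (of_nat (n + 1) * d_poly r (n + 1)) x =
      poly ([:1, 2:] * d_poly r n + [:of_nat n + 2 * r:] * d_poly r (n - 1)) x" for x
    using gbinomial_convolution_recurrence[OF assms, of "x + r" "x - r"]
    by (simp only: poly_mult poly_add poly_of_nat poly_d_poly) (simp add: algebra_simps)
  then show ?thesis
    by (simp add: poly_eq_poly_eq_iff[symmetric] fun_eq_iff)
qed

end
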